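(* Consider planar piecewise smooth vector fields $Z=(X,Y)$ with discontinuity set $\{x=0\}$, where $X=(f_1,f_2)$ applies for $x>0$ and $Y=(g_1,g_2)$ applies for $x<0$, and transition functions $\varphi$, not necessarily monotonic. After linear regularization and directional blow-up, it is possible to generate normally hyperbolic points, SF-fold singularities and SF-transcritical singularities; that is, for each of these three types there exist $Z$ and $\varphi$ such that the origin is a point of that type for the associated slow-fast system. However, it is not possible to generate SF-pitchfork singularities: there are no $Z$ and $\varphi$ for which the associated slow-fast system has an SF-pitchfork singularity at the origin.
   Context: $X,Y$ are smooth planar vector fields. A (not necessarily monotonic) transition function is a sufficiently smooth $\varphi:\mathbb{R}\to\mathbb{R}$ with $\varphi(t)=-1$ for $t\le-1$ and $\varphi(t)=1$ for $t\ge1$. Linear regularization: $\dot z=Z_\varepsilon(z)=\frac{1+\varphi(x/\varepsilon)}{2}X(z)+\frac{1-\varphi(x/\varepsilon)}{2}Y(z)$, $z=(x,y)$, $\varepsilon>0$. After the directional blow-up $(\tilde x,\tilde y,\varepsilon)\mapsto(\varepsilon\tilde x,\tilde y,\varepsilon)$ and dropping tildes one obtains the associated slow-fast system $$\varepsilon\dot x=f(x,y,\varepsilon)=\frac{f_1+g_1}{2}+\varphi(x)\frac{f_1-g_1}{2},\qquad \dot y=g(x,y,\varepsilon)=\frac{f_2+g_2}{2}+\varphi(x)\frac{f_2-g_2}{2},$$ with $f_i,g_i$ evaluated at $(\varepsilon x,y)$. Its critical set is $C_0=\{f(x,y,0)=0\}$. For a planar slow-fast system $\varepsilon\dot x=f(x,y,\varepsilon)$,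 $\dot y=g(x,y,\varepsilon)$, with all quantities evaluated at $(0,0,0)$: - the origin is a normally hyperbolic point if $f=0$ and $f_x\ne0$; - the origin is an SF-(generic) fold if $f=0$, $f_x=0$, $f_{xx}\neq0$, $f_y\ne0$, $g\neq0$; - the origin is an SF-(generic) transcritical singularity if $f=f_x=f_y=0$, $\det\operatorname{Hes}(f)<0$, $f_{xx}\neq0$, $g\ne0$, where $\operatorname{Hes}(f)$ is the Hessian of $f$ in $(x,y)$; - the origin is an SF-(generic) pitchfork singularity if $f=f_x=f_{xx}=f_y=0$, $f_{xxx}\neq0$, $f_{xy}\neq0$, $g\ne0$. *)

theory Defs
  imports "HOL-Analysis.Analysis"
begin

section \<open>Differentiability classes\<close>

text \<open>Class \<open>C\<^sup>n\<close> on the whole space.  The derivative is tested on each fixed direction \<open>v\<close>;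
  since the domain is finite-dimensional, this is the usual notion.\<close>

fun class_C :: "nat \<Rightarrow> ('a::euclidean_space \<Rightarrow> 'b::real_normed_vector) \<Rightarrow> bool" where
  "class_C 0 f \<longleftrightarrow> continuous_on UNIV f"
| "class_C (Suc n) f \<longleftrightarrow>
     (\<forall>x. f differentiable (at x)) \<and> (\<forall>v. class_C n (\<lambda>x. frechet_derivative f (at x) v))"

definition smooth :: "enat \<Rightarrow> ('a::euclidean_space \<Rightarrow> 'b::real_normed_vector) \<Rightarrow> bool" where
  "smooth r f \<longleftrightarrow> (\<forall>n. enat n \<le> r \<longrightarrow> class_C n f)"


section \<open>Linear regularization and the associated slow-fast system\<close>

text \<open>A piecewise smooth vector field with discontinuity set \<open>x = 0\<close> is given by the pair
  \<open>X\<close> (acting for \<open>x > 0\<close>) and \<open>Y\<close> (acting for \<open>x < 0\<close>), both defined on the whole plane.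
  Transition functions are not assumed to be monotonic.\<close>

type_synonym planar_field = "real \<times> real \<Rightarrow> real \<times> real"

definition transition_function :: "enat \<Rightarrow> (real \<Rightarrow> real) \<Rightarrow> bool" where
  "transition_function r \<phi> \<longleftrightarrow>
     smooth r \<phi> \<and> (\<forall>t\<le>-1. \<phi> t = -1) \<and> (\<forall>t\<ge>1. \<phi> t = 1)"

definition linear_regularization ::
    "planar_field \<Rightarrow> planar_field \<Rightarrow> (real \<Rightarrow> real) \<Rightarrow> real \<Rightarrow> planar_field" where
  "linear_regularization X Y \<phi> \<epsilon> z =
     ((1 + \<phi> (fst z / \<epsilon>)) / 2) *\<^sub>R X z + ((1 - \<phi> (fst z / \<epsilon>)) / 2) *\<^sub>R Y z"

text \<open>The right-hand sides of \<open>\<epsilon> x' = f(x, y, \<epsilon>)\<close>, \<open>y' = g(x, y, \<epsilon>)\<close>.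
  These expressions, unlike the regularization itself, also make sense for \<open>\<epsilon> = 0\<close>.\<close>

definition fast_component ::
    "planar_field \<Rightarrow> planar_field \<Rightarrow> (real \<Rightarrow> real) \<Rightarrow> real \<Rightarrow> real \<Rightarrow> real \<Rightarrow> real" where
  "fast_component X Y \<phi> x y \<epsilon> =
     (fst (X (\<epsilon> * x, y)) + fst (Y (\<epsilon> * x, y))) / 2
       + \<phi> x * ((fst (X (\<epsilon> * x, y)) - fst (Y (\<epsilon> * x, y))) / 2)"

definition slow_component ::
    "planar_field \<Rightarrow> planar_field \<Rightarrow> (real \<Rightarrow> real) \<Rightarrow> real \<Rightarrow> real \<Rightarrow> real \<Rightarrow> real" where
  "slow_component X Y \<phi> x y \<epsilon> =
     (snd (X (\<epsilon> * x, y)) + snd (Y (\<epsilon> * x, y))) / 2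
       + \<phi> x * ((snd (X (\<epsilon> * x, y)) - snd (Y (\<epsilon> * x, y))) / 2)"

lemma linear_regularization_outside:
  assumes "transition_function r \<phi>" "\<epsilon> > 0"
  shows "x \<ge> \<epsilon> \<Longrightarrow> linear_regularization X Y \<phi> \<epsilon> (x, y) = X (x, y)"
    and "x \<le> - \<epsilon> \<Longrightarrow> linear_regularization X Y \<phi> \<epsilon> (x, y) = Y (x, y)"
  using assms
  by (auto simp: linear_regularization_def transition_function_def field_simps)

text \<open>The directional blow-up replaces \<open>x\<close> by \<open>\<epsilon> x\<close>, which turns the first equation of the
  regularized system into \<open>\<epsilon> x' = f(x, y, \<epsilon>)\<close>.\<close>

lemma blow_up_linear_regularization:
  assumes "\<epsilon> > 0"
  shows "linear_regularization X Y \<phi> \<epsilon> (\<epsilon> * x, y) =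
           (fast_component X Y \<phi> x y \<epsilon>, slow_component X Y \<phi> x y \<epsilon>)"
  using assms
  by (intro prod_eqI)
     (simp_all add: linear_regularization_def fast_component_def slow_component_def field_simps)


section \<open>Singularities of planar slow-fast systems at the origin\<close>

definition Dx :: "(real \<Rightarrow> real \<Rightarrow> real \<Rightarrow> real) \<Rightarrow> real \<Rightarrow> real \<Rightarrow> real \<Rightarrow> real" where
  "Dx f x y \<epsilon> = deriv (\<lambda>s. f s y \<epsilon>) x"

definition Dy :: "(real \<Rightarrow> real \<Rightarrow> real \<Rightarrow> real) \<Rightarrow> real \<Rightarrow> real \<Rightarrow> real \<Rightarrow> real" where
  "Dy f x y \<epsilon> = deriv (\<lambda>s. f x s \<epsilon>) y"

definition Hes :: "(real \<Rightarrow> real \<Rightarrow> real \<Rightarrow> real) \<Rightarrow> real \<Rightarrow> real \<Rightarrow> real \<Rightarrow> real^2^2" where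
  "Hes f x y \<epsilon> = vector [vector [Dx (Dx f) x y \<epsilon>, Dy (Dx f) x y \<epsilon>],
                         vector [Dx (Dy f) x y \<epsilon>, Dy (Dy f) x y \<epsilon>]]"

text \<open>The predicates below are meant for \<open>f\<close> of class \<open>C\<^sup>3\<close> in \<open>(x, y)\<close>, since \<^const>\<open>deriv\<close> is
  unspecified where the derivative does not exist.\<close>

definition normally_hyperbolic_point ::
    "(real \<Rightarrow> real \<Rightarrow> real \<Rightarrow> real) \<Rightarrow> (real \<Rightarrow> real \<Rightarrow> real \<Rightarrow> real) \<Rightarrow> bool" where
  "normally_hyperbolic_point f g \<longleftrightarrow> f 0 0 0 = 0 \<and> Dx f 0 0 0 \<noteq> 0"

definition SF_fold ::
    "(real \<Rightarrow> real \<Rightarrow> real \<Rightarrow> real) \<Rightarrow> (real \<Rightarrow> real \<Rightarrow> real \<Rightarrow> real) \<Rightarrow> bool" where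
  "SF_fold f g \<longleftrightarrow>
     f 0 0 0 = 0 \<and> Dx f 0 0 0 = 0 \<and> Dx (Dx f) 0 0 0 \<noteq> 0 \<and> Dy f 0 0 0 \<noteq> 0 \<and> g 0 0 0 \<noteq> 0"

definition SF_transcritical ::
    "(real \<Rightarrow> real \<Rightarrow> real \<Rightarrow> real) \<Rightarrow> (real \<Rightarrow> real \<Rightarrow> real \<Rightarrow> real) \<Rightarrow> bool" where
  "SF_transcritical f g \<longleftrightarrow>
     f 0 0 0 = 0 \<and> Dx f 0 0 0 = 0 \<and> Dy f 0 0 0 = 0 \<and>
     det (Hes f 0 0 0) < 0 \<and> Dx (Dx f) 0 0 0 \<noteq> 0 \<and> g 0 0 0 \<noteq> 0"

definition SF_pitchfork ::
    "(real \<Rightarrow> real \<Rightarrow> real \<Rightarrow> real) \<Rightarrow> (real \<Rightarrow> real \<Rightarrow> real \<Rightarrow> real) \<Rightarrow> bool" where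
  "SF_pitchfork f g \<longleftrightarrow>
     f 0 0 0 = 0 \<and> Dx f 0 0 0 = 0 \<and> Dx (Dx f) 0 0 0 = 0 \<and> Dy f 0 0 0 = 0 \<and>
     Dx (Dx (Dx f)) 0 0 0 \<noteq> 0 \<and> Dy (Dx f) 0 0 0 \<noteq> 0 \<and> g 0 0 0 \<noteq> 0"

end

theory Submission
  imports Defs
begin

text \<open>
  At \<open>\<epsilon> = 0\<close> the fast component is \<open>f = a(y) + \<phi>(x) b(y)\<close>, so every \<open>x\<close>-derivative of \<open>f\<close>
  at the origin is a derivative of \<open>\<phi>\<close> times \<open>b(0)\<close>.  A pitchfork needs \<open>f\<^sub>x = 0\<close> and
  \<open>f\<^sub>x\<^sub>x\<^sub>x \<noteq> 0\<close>, hence \<open>b(0) \<noteq> 0\<close> and \<open>\<phi>'(0) = 0\<close>; but then \<open>f\<^sub>x\<^sub>y = \<phi>'(0) b'(0) = 0\<close>.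
  The other three types occur already for \<open>b = 1\<close>, that is \<open>f = a(y) + \<phi>(x)\<close>: take \<open>a = 0\<close> with
  \<open>\<phi>'(0) \<noteq> 0\<close> for a normally hyperbolic point, and a non-monotonic \<open>\<phi>\<close> with
  \<open>\<phi>(0) = \<phi>'(0) = 0 < \<phi>''(0)\<close> together with \<open>a = y\<close> (fold) or \<open>a = -y\<^sup>2\<close> (transcritical).
\<close>

section \<open>Calculus of the classes \<open>C\<^sup>n\<close>\<close>

lemma class_C_const: "class_C n (\<lambda>x. c)"
  by (induction n arbitrary: c) simp_all

lemma class_C_mult_right:
  fixes f :: "real \<Rightarrow> real"
  assumes "class_C n f"
  shows "class_C n (\<lambda>x. f x * c)"
  using assms
proof (induction n arbitrary: f)
  case 0
  then show ?case by (auto intro!: continuous_intros)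
next
  case (Suc n)
  have "frechet_derivative (\<lambda>x. f x * c) (at x) = (\<lambda>v. frechet_derivative f (at x) v * c)" for x
    using Suc.prems
    by (intro frechet_derivative_at[symmetric] has_derivative_mult_left)
      (simp add: frechet_derivative_works)
  then show ?case using Suc by (auto intro!: derivative_intros)
qed

text \<open>On the line the derivative in direction \<open>v\<close> is \<open>f' x * v\<close>, so
  all directional derivatives are constant multiples of \<open>f'\<close>. Together with
  \<open>class_C_SucD\<close> this replaces Frechet derivatives by ordinary ones in the inductions
  below.\<close>

lemma class_C_SucI:
  fixes f :: "real \<Rightarrow> real"
  assumes f: "\<And>x. (f has_real_derivative f' x) (at x)" and "class_C n f'"
  shows "class_C (Suc n) f"
proof -
  have "frechet_derivative f (at x) = (\<lambda>v. f' x * v)" for x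
    using f[of x] by (metis frechet_derivative_at has_field_derivative_def)
  moreover have "f differentiable (at x)" for x
    using f[of x] by (auto simp: real_differentiable_def)
  ultimately show ?thesis
    using assms(2) by (simp add: class_C_mult_right)
qed

lemma class_C_SucD:
  fixes f :: "real \<Rightarrow> real"
  assumes "class_C (Suc n) f"
  shows "(f has_real_derivative deriv f x) (at x)" and "class_C n (deriv f)"
proof -
  show *: "(f has_real_derivative deriv f x) (at x)" for x
    using assms by (simp add: DERIV_deriv_iff_real_differentiable)
  have "frechet_derivative f (at x) 1 = deriv f x" for x
    using *[of x] by (metis frechet_derivative_at has_field_derivative_def mult.right_neutral)
  moreover have "class_C n (\<lambda>x. frechet_derivative f (at x) 1)"
    using assms by simp
  ultimately show "class_C n (deriv f)" by simp
qed

lemma class_C_continuous_on: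
  fixes f :: "real \<Rightarrow> real"
  assumes "class_C n f"
  shows "continuous_on UNIV f"
proof (cases n)
  case (Suc m)
  then show ?thesis using class_C_SucD(1)[of m f] assms
    by (auto intro!: DERIV_continuous_on[where D="deriv f"])
qed (use assms in simp)

text \<open>Needed because the product, chain and quotient rules bring back the undifferentiated
  functions, which are assumed of class \<open>Suc n\<close> but enter the induction at level
  \<open>n\<close>.\<close>

lemma class_C_lower:
  fixes f :: "real \<Rightarrow> real"
  assumes "class_C (Suc n) f"
  shows "class_C n f"
  using assms
proof (induction n arbitrary: f)
  case 0
  show ?case using class_C_continuous_on[OF 0] by simp
next
  case (Suc n)
  note d = class_C_SucD[OF Suc.prems]
  show ?case by (rule class_C_SucI[OF d(1) Suc.IH[OF d(2)]])
qed

lemma class_C_add: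
  fixes f g :: "real \<Rightarrow> real"
  assumes "class_C n f" "class_C n g"
  shows "class_C n (\<lambda>x. f x + g x)"
  using assms
proof (induction n arbitrary: f g)
  case 0
  then show ?case by (auto intro!: continuous_intros)
next
  case (Suc n)
  note d = class_C_SucD[OF Suc.prems(1)] class_C_SucD[OF Suc.prems(2)]
  show ?case
    by (rule class_C_SucI[OF DERIV_add[OF d(1) d(3)] Suc.IH[OF d(2) d(4)]])
qed

lemma class_C_mult:
  fixes f g :: "real \<Rightarrow> real"
  assumes "class_C n f" "class_C n g"
  shows "class_C n (\<lambda>x. f x * g x)"
  using assms
proof (induction n arbitrary: f g)
  case 0
  then show ?case by (auto intro!: continuous_intros)
next
  case (Suc n)
  note d = class_C_SucD[OF Suc.prems(1)] class_C_SucD[OF Suc.prems(2)]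
  note l = class_C_lower[OF Suc.prems(1)] class_C_lower[OF Suc.prems(2)]
  show ?case
    by (rule class_C_SucI[OF DERIV_mult[OF d(1) d(3)]
          class_C_add[OF Suc.IH[OF d(2) l(2)] Suc.IH[OF d(4) l(1)]]])
qed

lemma class_C_diff:
  fixes f g :: "real \<Rightarrow> real"
  assumes "class_C n f" "class_C n g"
  shows "class_C n (\<lambda>x. f x - g x)"
  using class_C_add[OF assms(1) class_C_mult_right[OF assms(2), of "-1"]] by simp

lemma class_C_ident: "class_C n (\<lambda>x::real. x)"
proof (cases n)
  case (Suc m)
  then show ?thesis
    using class_C_SucI[OF DERIV_ident class_C_const, of m] by simp
qed simp

lemma class_C_power:
  fixes f :: "real \<Rightarrow> real"
  assumes "class_C n f"
  shows "class_C n (\<lambda>x. f x ^ k)"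
  by (induction k) (simp_all add: class_C_const class_C_mult assms)

lemma class_C_compose:
  fixes f g :: "real \<Rightarrow> real"
  assumes "class_C n f" "class_C n g"
  shows "class_C n (\<lambda>x. f (g x))"
  using assms
proof (induction n arbitrary: f g)
  case 0
  then show ?case by (auto intro: continuous_on_compose2)
next
  case (Suc n)
  note d = class_C_SucD[OF Suc.prems(1)] class_C_SucD[OF Suc.prems(2)]
  show ?case
    by (rule class_C_SucI[OF DERIV_chain2[OF d(1) d(3)]
          class_C_mult[OF Suc.IH[OF d(2) class_C_lower[OF Suc.prems(2)]] d(4)]])
qed

text \<open>Since (1/f)' = -(1/f)^2 f', the induction hypothesis on 1/f itself supplies the factors
  of its derivative, and \<open>f\<close> can stay fixed.\<close>

lemma class_C_inverse:
  fixes f :: "real \<Rightarrow> real"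
  assumes "class_C n f" and nz: "\<And>x. f x \<noteq> 0"
  shows "class_C n (\<lambda>x. inverse (f x))"
  using assms(1)
proof (induction n)
  case 0
  then show ?case using nz by (auto intro!: continuous_intros)
next
  case (Suc n)
  note d = class_C_SucD[OF Suc.prems]
  note i = Suc.IH[OF class_C_lower[OF Suc.prems]]
  have der: "((\<lambda>x. inverse (f x)) has_real_derivative
      inverse (f x) * inverse (f x) * deriv f x * -1) (at x)" for x
    using DERIV_inverse'[OF d(1) nz, of x] by (simp add: mult_ac)
  show ?case
    by (rule class_C_SucI[OF der]) (intro class_C_mult_right class_C_mult i d)
qed

text \<open>The derivative in direction \<open>v\<close> is again such a pair, with
  \<open>deriv A\<close> times \<open>snd v\<close> in the first slot and 0 in the second; hence the
  induction must vary both \<open>A\<close> and \<open>k\<close>.\<close>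

lemma class_C_pair_snd:
  fixes A :: "real \<Rightarrow> real"
  assumes "class_C n A"
  shows "class_C n (\<lambda>z::real \<times> real. (A (snd z), k::real))"
  using assms
proof (induction n arbitrary: A k)
  case 0
  then have "continuous_on UNIV (\<lambda>z::real \<times> real. A (snd z))"
    by (auto intro: continuous_on_compose2[OF _ continuous_on_snd[OF continuous_on_id]])
  then show ?case by (simp add: continuous_on_Pair)
next
  case (Suc n)
  note d = class_C_SucD[OF Suc.prems]
  have der: "((\<lambda>z::real \<times> real. (A (snd z), k)) has_derivative
      (\<lambda>v. (deriv A (snd z) * snd v, 0))) (at z)" for z
  proof (rule has_derivative_Pair[OF _ has_derivative_const])
    have "(A has_derivative (*) (deriv A (snd z))) (at (snd z))"
      using d(1) by (simp add: has_field_derivative_def)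
    from has_derivative_compose[OF has_derivative_snd[OF has_derivative_ident] this]
    show "((\<lambda>z. A (snd z)) has_derivative (\<lambda>v. deriv A (snd z) * snd v)) (at z)" .
  qed
  have "class_C n (\<lambda>z::real \<times> real. (deriv A (snd z) * snd v, 0::real))" for v :: "real \<times> real"
    by (rule Suc.IH[OF class_C_mult_right[OF d(2)]])
  moreover have "(\<lambda>z::real \<times> real. (A (snd z), k)) differentiable (at z)" for z
    using der by (rule differentiableI)
  ultimately show ?case
    by (simp add: frechet_derivative_at[OF der, symmetric])
qed


section \<open>Smooth transition functions\<close>

text \<open>For t > 0 this is s^k e^(-s) with s = 1/t. The power k is carried along because
  differentiation stays within linear combinations of this family.\<close>

definition flat_exp :: "nat \<Rightarrow> real \<Rightarrow> real" where
  "flat_exp k t = (if t > 0 then inverse t ^ k * exp (- inverse t) else 0)"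

text \<open>From the right the difference quotient is s^(k+1) / e^s with s = 1/h tending to
  infinity; from the left it is 0.\<close>

lemma flat_exp_has_derivative_0: "(flat_exp k has_real_derivative 0) (at 0)"
proof -
  have "((\<lambda>h. flat_exp k h / h) \<longlongrightarrow> 0) (at_right 0)"
  proof (rule Lim_transform_eventually)
    have "((\<lambda>s::real. s ^ Suc k / exp s) \<longlongrightarrow> 0) at_top"
      by (rule tendsto_power_div_exp_0)
    then show "((\<lambda>h::real. inverse h ^ Suc k / exp (inverse h)) \<longlongrightarrow> 0) (at_right 0)"
      by (rule filterlim_compose[OF _ filterlim_inverse_at_top_right])
    show "\<forall>\<^sub>F h in at_right 0. inverse h ^ Suc k / exp (inverse h) = flat_exp k h / h"
      by (rule eventually_at_right_less[THEN eventually_mono])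
        (simp add: flat_exp_def exp_minus field_simps)
  qed
  moreover have "((\<lambda>h. flat_exp k h / h) \<longlongrightarrow> 0) (at_left 0)"
    by (rule Lim_transform_eventually[OF tendsto_const])
      (auto simp: flat_exp_def eventually_at_filter)
  ultimately have "((\<lambda>h. flat_exp k h / h) \<longlongrightarrow> 0) (at 0)"
    by (simp add: filterlim_split_at)
  then show ?thesis by (simp add: DERIV_def flat_exp_def)
qed

text \<open>For t > 0, ds/dt = -s^2 turns k s^(k-1) - s^k into s^(k+2) - k s^(k+1), up to the common
  factor e^(-s). For t <= 0 both terms on the right are 0 by the default value.\<close>

lemma flat_exp_has_derivative:
  "(flat_exp k has_real_derivative flat_exp (k + 2) t - flat_exp (k + 1) t * real k) (at t)"
proof (cases t "0::real" rule: linorder_cases)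
  case less
  have "\<forall>\<^sub>F x in nhds t. flat_exp k x = 0"
    using eventually_nhds_in_open[of "{..<0}" t] less
    by (auto elim!: eventually_mono simp: flat_exp_def)
  then show ?thesis using less
    by (subst DERIV_cong_ev[OF refl _ refl, where g="\<lambda>_. 0"]) (auto simp: flat_exp_def)
next
  case equal
  then show ?thesis using flat_exp_has_derivative_0[of k] by (simp add: flat_exp_def)
next
  case greater
  have "\<forall>\<^sub>F x in nhds t. flat_exp k x = inverse x ^ k * exp (- inverse x)"
    using eventually_nhds_in_open[of "{0<..}" t] greater
    by (auto elim!: eventually_mono simp: flat_exp_def)
  moreover have "((\<lambda>x. inverse x ^ k * exp (- inverse x)) has_real_derivative
      flat_exp (k + 2) t - flat_exp (k + 1) t * real k) (at t)"
  proof -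
    let ?s = "inverse t"
    have i: "(inverse has_real_derivative - (?s * ?s)) (at t)"
      using DERIV_inverse[of t UNIV] greater by (simp add: power2_eq_square)
    \<comment> \<open>At k = 0 the truncated exponent is 0 instead of -1; the factor
      \<open>real k\<close> then makes both sides 0.\<close>
    have e: "real k * ?s ^ (k - Suc 0) * ?s = real k * ?s ^ k"
      by (cases k) simp_all
    show ?thesis
    proof (rule DERIV_cong[OF DERIV_mult[OF DERIV_power[OF i] DERIV_fun_exp[OF DERIV_minus[OF i]]]])
      have "real k * (- (?s * ?s) * ?s ^ (k - Suc 0)) * exp (- ?s) =
          - (real k * ?s ^ (k - Suc 0) * ?s) * (?s * exp (- ?s))"
        by (simp add: mult_ac)
      also have "\<dots> = - (real k * ?s ^ k) * (?s * exp (- ?s))"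
        by (simp only: e)
      also have "\<dots> + exp (- ?s) * (- (- (?s * ?s))) * ?s ^ k =
          flat_exp (k + 2) t - flat_exp (k + 1) t * real k"
        using greater by (simp add: flat_exp_def power2_eq_square algebra_simps)
      finally show "real k * (- (?s * ?s) * ?s ^ (k - Suc 0)) * exp (- ?s) +
          exp (- ?s) * (- (- (?s * ?s))) * ?s ^ k =
          flat_exp (k + 2) t - flat_exp (k + 1) t * real k" .
    qed
  qed
  ultimately show ?thesis
    by (subst DERIV_cong_ev[OF refl _ refl])
qed

lemma class_C_flat_exp: "class_C n (flat_exp k)"
proof (induction n arbitrary: k)
  case 0
  show ?case using flat_exp_has_derivative
    by (auto intro!: DERIV_continuous_on[where D="\<lambda>t. flat_exp (k + 2) t - flat_exp (k + 1) t * real k"])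
next
  case (Suc n)
  show ?case
    by (intro class_C_SucI[OF flat_exp_has_derivative] class_C_diff class_C_mult_right Suc.IH)
qed

text \<open>The usual smooth cutoff quotient, made odd and rescaled to go from -1 to 1: beyond
  either end one of the two flat terms vanishes and the quotient is exactly 1 or -1.\<close>

definition smooth_step :: "real \<Rightarrow> real" where
  "smooth_step t = (flat_exp 0 (1 + t) - flat_exp 0 (1 - t)) *
     inverse (flat_exp 0 (1 + t) + flat_exp 0 (1 - t))"

text \<open>The arguments add up to 2, so at least one is positive, and \<open>flat_exp\<close> is
  never negative.\<close>

lemma flat_exp_sum_pos: "flat_exp 0 (1 + t) + flat_exp 0 (1 - t) > 0"
  by (auto simp: flat_exp_def add_pos_pos)

lemma class_C_smooth_step: "class_C n smooth_step"
proof -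
  have p: "class_C n (\<lambda>t. flat_exp 0 (1 + t))"
    by (intro class_C_compose[OF class_C_flat_exp] class_C_add class_C_const class_C_ident)
  have m: "class_C n (\<lambda>t. flat_exp 0 (1 - t))"
    by (intro class_C_compose[OF class_C_flat_exp] class_C_diff class_C_const class_C_ident)
  have "class_C n (\<lambda>t. (flat_exp 0 (1 + t) - flat_exp 0 (1 - t)) *
     inverse (flat_exp 0 (1 + t) + flat_exp 0 (1 - t)))"
    using flat_exp_sum_pos
    by (intro class_C_mult class_C_inverse class_C_add class_C_diff p m) (simp add: less_imp_neq[symmetric])
  then show ?thesis by (simp add: smooth_step_def[abs_def])
qed

lemma smooth_step_0: "smooth_step 0 = 0"
  by (simp add: smooth_step_def)

lemma smooth_step_le: "t \<le> -1 \<Longrightarrow> smooth_step t = -1"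
  by (simp add: smooth_step_def flat_exp_def)

lemma smooth_step_ge: "t \<ge> 1 \<Longrightarrow> smooth_step t = 1"
  by (simp add: smooth_step_def flat_exp_def)

text \<open>At 0 the numerator vanishes and has slope 2/e, while the denominator equals 2/e.\<close>

lemma deriv_smooth_step_0: "deriv smooth_step 0 = 1"
proof -
  have "(flat_exp 0 has_real_derivative exp (-1)) (at 1)"
    using flat_exp_has_derivative[of 0 1] by (simp add: flat_exp_def)
  moreover have "((\<lambda>t::real. 1 + t) has_real_derivative 1) (at 0)"
      "((\<lambda>t::real. 1 - t) has_real_derivative - 1) (at 0)"
    by (auto intro!: derivative_eq_intros)
  ultimately have p: "((\<lambda>t. flat_exp 0 (1 + t)) has_real_derivative exp (-1)) (at 0)"
    and m: "((\<lambda>t. flat_exp 0 (1 - t)) has_real_derivative - exp (-1)) (at 0)"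
    using DERIV_chain2[of "flat_exp 0" "exp (-1)" "\<lambda>t. 1 + t" 0 1 UNIV]
      DERIV_chain2[of "flat_exp 0" "exp (-1)" "\<lambda>t. 1 - t" 0 "-1" UNIV]
    by simp_all
  have "(smooth_step has_real_derivative 1) (at 0)"
    unfolding smooth_step_def[abs_def]
    by (rule derivative_eq_intros p m refl)+ (simp_all add: flat_exp_def field_simps)
  then show ?thesis by (rule DERIV_imp_deriv)
qed

lemma transition_function_smooth_step: "transition_function r smooth_step"
  by (simp add: transition_function_def smooth_def class_C_smooth_step smooth_step_le smooth_step_ge)

text \<open>The quintic maps \<open>(-\<infinity>, -1]\<close> and \<open>[1, \<infinity>)\<close> into themselves and has a
  nondegenerate critical point at \<open>0\<close>, with value \<open>0\<close>.\<close>

definition folded_step :: "real \<Rightarrow> real" where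
  "folded_step t = smooth_step (t ^ 5 - t ^ 4 + t ^ 2)"

text \<open>At t = 1 and t = -1 the terms -t^4 and t^2 cancel, leaving t^5; outside [-1, 1] the
  quintic stays beyond these values, where \<open>smooth_step\<close> is constant.\<close>

lemma transition_function_folded_step: "transition_function r folded_step"
proof -
  have "class_C n folded_step" for n
    unfolding folded_step_def[abs_def]
    by (intro class_C_compose[OF class_C_smooth_step] class_C_add class_C_diff class_C_power class_C_ident)
  moreover have "folded_step t = 1" if "t \<ge> 1" for t
  proof -
    have "t ^ 5 - t ^ 4 + t ^ 2 - 1 = (t - 1) * (t ^ 4 + t + 1)" by algebra
    also have "\<dots> \<ge> 0" using that by simp
    finally show ?thesis by (simp add: folded_step_def smooth_step_ge)
  qed
  moreover have "folded_step t = -1" if "t \<le> -1" for t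
  proof -
    have "1 \<le> (- t) ^ 5"
      using that by (intro one_le_power) simp
    moreover have "(- t) ^ 2 \<le> (- t) ^ 4"
      using that by (intro power_increasing) simp_all
    ultimately have "t ^ 5 - t ^ 4 + t ^ 2 \<le> - 1" by simp
    then show ?thesis by (simp add: folded_step_def smooth_step_le)
  qed
  ultimately show ?thesis by (simp add: transition_function_def smooth_def)
qed

lemma folded_step_0: "folded_step 0 = 0"
  by (simp add: folded_step_def smooth_step_0)

lemma deriv_folded_step:
  "deriv folded_step = (\<lambda>t. deriv smooth_step (t ^ 5 - t ^ 4 + t ^ 2) * (5 * t ^ 4 - 4 * t ^ 3 + 2 * t))"
proof
  fix t :: real
  have "((\<lambda>t::real. t ^ 5 - t ^ 4 + t ^ 2) has_real_derivative 5 * t ^ 4 - 4 * t ^ 3 + 2 * t) (at t)"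
    by (auto intro!: derivative_eq_intros)
  then have "(folded_step has_real_derivative
      deriv smooth_step (t ^ 5 - t ^ 4 + t ^ 2) * (5 * t ^ 4 - 4 * t ^ 3 + 2 * t)) (at t)"
    unfolding folded_step_def[abs_def]
    by (rule DERIV_chain2[OF class_C_SucD(1)[OF class_C_smooth_step]])
  then show "deriv folded_step t =
      deriv smooth_step (t ^ 5 - t ^ 4 + t ^ 2) * (5 * t ^ 4 - 4 * t ^ 3 + 2 * t)"
    by (rule DERIV_imp_deriv)
qed

lemma deriv_deriv_folded_step_0: "deriv (deriv folded_step) 0 = 2"
proof -
  have q: "((\<lambda>t::real. t ^ 5 - t ^ 4 + t ^ 2) has_real_derivative 0) (at 0)"
    by (auto intro!: derivative_eq_intros)
  have p: "((\<lambda>t::real. 5 * t ^ 4 - 4 * t ^ 3 + 2 * t) has_real_derivative 2) (at 0)"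
    by (auto intro!: derivative_eq_intros)
  \<comment> \<open>The inner slope is 0 at the origin, so the second derivative of
    \<open>smooth_step\<close> enters with factor 0 and only \<open>deriv smooth_step 0 * 2\<close>
    survives.\<close>
  have "((\<lambda>t. deriv smooth_step (t ^ 5 - t ^ 4 + t ^ 2)) has_real_derivative
      deriv (deriv smooth_step) (0 ^ 5 - 0 ^ 4 + 0 ^ 2) * 0) (at 0)"
    by (rule DERIV_chain2[OF class_C_SucD(1)[OF class_C_SucD(2)[OF class_C_smooth_step]] q])
  from DERIV_mult[OF this p] show ?thesis
    unfolding deriv_folded_step
    by (intro DERIV_imp_deriv) (simp add: deriv_smooth_step_0)
qed


section \<open>Singularities of the regularized system\<close>

text \<open>With c = 1 for \<open>X\<close> and c = -1 for \<open>Y\<close>, the first components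
  have half-sum \<open>\<alpha>\<close> and half-difference 1, which is the case b = 1. The second
  component 1 keeps the slow component nonzero.\<close>

definition shear_field :: "(real \<Rightarrow> real) \<Rightarrow> real \<Rightarrow> planar_field" where
  "shear_field \<alpha> c z = (\<alpha> (snd z) + c, 1)"

lemma smooth_shear_field:
  assumes "\<And>n. class_C n \<alpha>"
  shows "smooth r (shear_field \<alpha> c)"
  unfolding smooth_def shear_field_def[abs_def]
  by (intro allI impI class_C_pair_snd[where A="\<lambda>y. \<alpha> y + c"] class_C_add assms class_C_const)

lemma fast_component_shear_field:
  "fast_component (shear_field \<alpha> 1) (shear_field \<alpha> (-1)) \<phi> = (\<lambda>x y \<epsilon>. \<alpha> y + \<phi> x)"
  by (simp add: fun_eq_iff fast_component_def shear_field_def)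

lemma slow_component_shear_field:
  "slow_component (shear_field \<alpha> c) (shear_field \<alpha> d) \<phi> = (\<lambda>x y \<epsilon>. 1)"
  by (simp add: fun_eq_iff slow_component_def shear_field_def)

text \<open>Both sides have the same difference quotients, so they agree even where \<open>f\<close>
  is not differentiable.\<close>

lemma deriv_const_add: "deriv (\<lambda>x. c + f x) x = deriv f x" for f :: "real \<Rightarrow> real"
  unfolding deriv_def DERIV_def by simp

lemma Dx_separated: "Dx (\<lambda>x y \<epsilon>. \<alpha> y + \<phi> x) = (\<lambda>x y \<epsilon>. deriv \<phi> x)"
  by (simp add: fun_eq_iff Dx_def deriv_const_add)

lemma Dy_separated: "Dy (\<lambda>x y \<epsilon>. \<alpha> y + \<phi> x) = (\<lambda>x y \<epsilon>. deriv \<alpha> y)"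
  by (simp add: fun_eq_iff Dy_def deriv_const_add add.commute[of "\<alpha> _"])

lemma no_SF_pitchfork:
  assumes "\<And>x. \<phi> differentiable (at x)"
  shows "\<not> SF_pitchfork (fast_component X Y \<phi>) g"
proof
  let ?f = "fast_component X Y \<phi>"
  define b where "b y = (fst (X (0, y)) - fst (Y (0, y))) / 2" for y
  assume *: "SF_pitchfork ?f g"
  have Dxf: "Dx ?f x y 0 = deriv \<phi> x * b y" for x y
  proof -
    \<comment> \<open>At \<open>\<epsilon> = 0\<close> the fields are evaluated at
      \<open>(0, y)\<close>, so they are constant in \<open>s\<close> and only \<open>\<phi>\<close>
      is differentiated.\<close>
    have "((\<lambda>s. ?f s y 0) has_real_derivative 0 + deriv \<phi> x * b y) (at x)"
      unfolding fast_component_def mult_zero_left b_def[symmetric]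
      by (intro DERIV_add DERIV_const DERIV_cmult_right)
        (simp add: DERIV_deriv_iff_real_differentiable assms)
    then show ?thesis by (simp add: Dx_def DERIV_imp_deriv)
  qed
  have "b 0 \<noteq> 0"
  proof
    assume "b 0 = 0"
    \<comment> \<open>\<open>Dx ?f\<close> vanishes along the whole line y = 0, hence so do its
      further x-derivatives.\<close>
    then have "Dx (Dx (Dx ?f)) 0 0 0 = 0"
      by (simp add: Dxf Dx_def[of "Dx ?f"] Dx_def[of "Dx (Dx ?f)"])
    with * show False by (simp add: SF_pitchfork_def)
  qed
  with * have "deriv \<phi> 0 = 0" by (simp add: SF_pitchfork_def Dxf)
  \<comment> \<open>\<open>Dx ?f\<close> vanishes along the whole line x = 0, so the zero function
    is differentiated in y.\<close>
  then have "Dy (Dx ?f) 0 0 0 = 0" by (simp add: Dy_def Dxf)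
  with * show False by (simp add: SF_pitchfork_def)
qed

theorem theorem2:
  fixes r :: enat
  assumes "3 \<le> r"
  shows "(\<exists>X Y \<phi>. smooth \<infinity> X \<and> smooth \<infinity> Y \<and> transition_function r \<phi> \<and>
            normally_hyperbolic_point (fast_component X Y \<phi>) (slow_component X Y \<phi>)) \<and>
         (\<exists>X Y \<phi>. smooth \<infinity> X \<and> smooth \<infinity> Y \<and> transition_function r \<phi> \<and>
            SF_fold (fast_component X Y \<phi>) (slow_component X Y \<phi>)) \<and>
         (\<exists>X Y \<phi>. smooth \<infinity> X \<and> smooth \<infinity> Y \<and> transition_function r \<phi> \<and>
            SF_transcritical (fast_component X Y \<phi>) (slow_component X Y \<phi>)) \<and>
         \<not> (\<exists>X Y \<phi>. smooth \<infinity> X \<and> smooth \<infinity> Y \<and> transition_function r \<phi> \<and>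
            SF_pitchfork (fast_component X Y \<phi>) (slow_component X Y \<phi>))"
proof (intro conjI)
  show "\<exists>X Y \<phi>. smooth \<infinity> X \<and> smooth \<infinity> Y \<and> transition_function r \<phi> \<and>
      normally_hyperbolic_point (fast_component X Y \<phi>) (slow_component X Y \<phi>)"
  proof (intro exI conjI)
    let ?\<alpha> = "\<lambda>y::real. 0::real"
    show "smooth \<infinity> (shear_field ?\<alpha> 1)" "smooth \<infinity> (shear_field ?\<alpha> (-1))"
      by (intro smooth_shear_field class_C_const)+
    show "normally_hyperbolic_point
        (fast_component (shear_field ?\<alpha> 1) (shear_field ?\<alpha> (-1)) smooth_step)
        (slow_component (shear_field ?\<alpha> 1) (shear_field ?\<alpha> (-1)) smooth_step)"
      unfolding normally_hyperbolic_point_def fast_component_shear_field Dx_separated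
      by (simp add: smooth_step_0 deriv_smooth_step_0)
  qed (rule transition_function_smooth_step)
next
  show "\<exists>X Y \<phi>. smooth \<infinity> X \<and> smooth \<infinity> Y \<and> transition_function r \<phi> \<and>
      SF_fold (fast_component X Y \<phi>) (slow_component X Y \<phi>)"
  proof (intro exI conjI)
    let ?\<alpha> = "\<lambda>y::real. y"
    show "smooth \<infinity> (shear_field ?\<alpha> 1)" "smooth \<infinity> (shear_field ?\<alpha> (-1))"
      by (intro smooth_shear_field class_C_ident)+
    have "Dx (\<lambda>x y \<epsilon>. deriv folded_step x) 0 0 0 = 2"
      by (simp add: Dx_def deriv_deriv_folded_step_0)
    then show "SF_fold
        (fast_component (shear_field ?\<alpha> 1) (shear_field ?\<alpha> (-1)) folded_step)
        (slow_component (shear_field ?\<alpha> 1) (shear_field ?\<alpha> (-1)) folded_step)"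
      unfolding SF_fold_def fast_component_shear_field slow_component_shear_field
        Dx_separated Dy_separated
      by (simp add: folded_step_0 deriv_folded_step)
  qed (rule transition_function_folded_step)
next
  show "\<exists>X Y \<phi>. smooth \<infinity> X \<and> smooth \<infinity> Y \<and> transition_function r \<phi> \<and>
      SF_transcritical (fast_component X Y \<phi>) (slow_component X Y \<phi>)"
  proof (intro exI conjI)
    \<comment> \<open>Written as a difference so that \<open>class_C_diff\<close> applies.\<close>
    let ?\<alpha> = "\<lambda>y::real. 0 - y ^ 2"
    show "smooth \<infinity> (shear_field ?\<alpha> 1)" "smooth \<infinity> (shear_field ?\<alpha> (-1))"
      by (intro smooth_shear_field class_C_diff class_C_const class_C_power class_C_ident)+
    have d\<alpha>: "deriv ?\<alpha> = (\<lambda>y. - 2 * y)"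
      by (intro ext DERIV_imp_deriv) (auto intro!: derivative_eq_intros)
    have dd\<alpha>: "deriv (\<lambda>y::real. - 2 * y) 0 = - 2"
      by (intro DERIV_imp_deriv) (auto intro!: derivative_eq_intros)
    \<comment> \<open>The Hessian is diagonal with entries 2 and -2, so its determinant is
      -4.\<close>
    have "Dx (\<lambda>x y \<epsilon>. deriv folded_step x) 0 0 0 = 2"
      and "Dy (\<lambda>x y \<epsilon>. deriv folded_step x) 0 0 0 = 0"
      and "Dx (\<lambda>x y \<epsilon>. deriv ?\<alpha> y) 0 0 0 = 0"
      and "Dy (\<lambda>x y \<epsilon>. deriv ?\<alpha> y) 0 0 0 = - 2"
      unfolding Dx_def Dy_def d\<alpha> dd\<alpha> by (simp_all add: deriv_deriv_folded_step_0)
    moreover have "deriv folded_step 0 = 0" "deriv ?\<alpha> 0 = 0"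
      unfolding d\<alpha> by (simp_all add: deriv_folded_step)
    ultimately show "SF_transcritical
        (fast_component (shear_field ?\<alpha> 1) (shear_field ?\<alpha> (-1)) folded_step)
        (slow_component (shear_field ?\<alpha> 1) (shear_field ?\<alpha> (-1)) folded_step)"
      unfolding SF_transcritical_def fast_component_shear_field slow_component_shear_field
        Hes_def Dx_separated Dy_separated
      by (simp add: folded_step_0 det_2)
  qed (rule transition_function_folded_step)
next
  have "\<phi> differentiable (at x)" if "transition_function r \<phi>" for \<phi> x
  proof -
    have "enat (Suc 0) \<le> r"
      using assms by (rule order_trans[rotated]) (simp add: numeral_eq_enat)
    with that have "class_C (Suc 0) \<phi>"
      by (simp only: transition_function_def smooth_def)
    then show ?thesis by simp
  qed
  then show "\<not> (\<exists>X Y \<phi>. smooth \<infinity> X \<and> smooth \<infinity> Y \<and> transition_function r \<phi> \<and>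
      SF_pitchfork (fast_component X Y \<phi>) (slow_component X Y \<phi>))"
    using no_SF_pitchfork by blast
qed

end
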